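(* Let $W$ be a finite reflection group acting on $\mathbb{R}^d$ with reflection arrangement $\mathcal{A}(W)$. Then $\mathcal{A}(W)$ is strongly inscribable, and for every flat $L$ of $\mathcal{A}(W)$ the restriction $\mathcal{A}(W)^L=\{H\cap L: H\in\mathcal{A}(W),\ L\not\subseteq H\}$ is a strongly inscribable arrangement in $L$.
   Context: A finite reflection group is a finite subgroup of the orthogonal group of $\mathbb{R}^d$ generated by orthogonal reflections $s_\alpha$ in linear hyperplanes $\alpha^\perp$; its reflection arrangement is $\mathcal{A}(W)=\{\alpha^\perp : s_\alpha\in W\}$. A flat of an arrangement of linear hyperplanes is an intersection of some of its hyperplanes. The regions of an arrangement (closures of the connected components of the complement of the union of the hyperplanes) and their faces form a complete fan. The normal fan of a polytope $P$ is the collection of the normal cones $\{c:\langle c,x\rangle=\max_{y\in P}\langle c,y\rangle\ \forall x\in F\}$ of nonempty faces $F$ of $P$. A zonotope is a translate of a Minkowski sum of segments $[-z_1,z_1]+\cdots+[-z_n,z_n]$; a polytope is inscribed if its vertices lie on a common sphere. An arrangement is strongly inscribable if it has an inscribed zonotope, i.e. there is an inscribed zonotope whose normal fan is the fan of the arrangement. The inner product on $L$ is the restriction of that on $\mathbb{R}^d$. *)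

theory Defs
  imports "HOL-Analysis.Analysis" "HOL-Library.Set_Algebras" "HOL-Algebra.Generated_Groups"
begin

section \<open>Finite reflection groups\<close>

definition reflection :: "'a::euclidean_space \<Rightarrow> 'a \<Rightarrow> 'a" where
  "reflection \<alpha> x = x - (2 * (\<alpha> \<bullet> x) / (\<alpha> \<bullet> \<alpha>)) *\<^sub>R \<alpha>"

definition hyperplane_perp :: "'a::euclidean_space \<Rightarrow> 'a set" where
  "hyperplane_perp \<alpha> = {x. \<alpha> \<bullet> x = 0}"

definition orthogonal_group :: "('a::euclidean_space \<Rightarrow> 'a) monoid" where
  "orthogonal_group = \<lparr>carrier = {f. orthogonal_transformation f}, mult = (\<circ>), one = id\<rparr>"

lemma group_orthogonal_group: "group (orthogonal_group :: ('a::euclidean_space \<Rightarrow> 'a) monoid)"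
proof (rule groupI)
  fix f :: "'a \<Rightarrow> 'a"
  assume "f \<in> carrier orthogonal_group"
  then have f: "orthogonal_transformation f"
    by (simp add: orthogonal_group_def)
  then have "Hilbert_Choice.inv f \<circ> f = id"
    using inv_o_cancel orthogonal_transformation_inj by blast
  with orthogonal_transformation_inv[OF f]
  show "\<exists>g\<in>carrier orthogonal_group. g \<otimes>\<^bsub>orthogonal_group\<^esub> f = \<one>\<^bsub>orthogonal_group\<^esub>"
    by (auto simp: orthogonal_group_def)
qed (auto simp: orthogonal_group_def orthogonal_transformation_compose id_def comp_assoc)

text \<open>The vectors \<open>\<alpha>\<close> are required to be nonzero throughout: the formula above gives
  \<open>reflection 0 = id\<close>, which is not a reflection.\<close>

definition finite_reflection_group :: "('a::euclidean_space \<Rightarrow> 'a) set \<Rightarrow> bool" where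
  "finite_reflection_group W \<longleftrightarrow>
     finite W \<and> subgroup W orthogonal_group \<and>
     (\<exists>R. R \<subseteq> {reflection \<alpha> |\<alpha>. \<alpha> \<noteq> 0} \<and> W = generate orthogonal_group R)"

definition reflection_arrangement :: "('a::euclidean_space \<Rightarrow> 'a) set \<Rightarrow> 'a set set" where
  "reflection_arrangement W = {hyperplane_perp \<alpha> |\<alpha>. \<alpha> \<noteq> 0 \<and> reflection \<alpha> \<in> W}"

section \<open>Arrangements of linear hyperplanes\<close>

text \<open>An arrangement lives in a linear subspace \<open>V\<close> of the ambient Euclidean space, with the
  restricted inner product. The empty arrangement is allowed; for \<open>V = {0}\<close> it is the only one.\<close>

definition linear_arrangement :: "'a::euclidean_space set \<Rightarrow> 'a set set \<Rightarrow> bool" where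
  "linear_arrangement V \<A> \<longleftrightarrow>
     subspace V \<and> finite \<A> \<and> (\<forall>H\<in>\<A>. subspace H \<and> H \<subseteq> V \<and> dim H + 1 = dim V)"

text \<open>Flats of an arrangement in the whole space; the empty intersection \<open>UNIV\<close> is a flat.\<close>

definition flats :: "'a::euclidean_space set set \<Rightarrow> 'a set set" where
  "flats \<A> = {\<Inter>\<B> |\<B>. \<B> \<subseteq> \<A>}"

definition restriction :: "'a::euclidean_space set set \<Rightarrow> 'a set \<Rightarrow> 'a set set" where
  "restriction \<A> L = {H \<inter> L |H. H \<in> \<A> \<and> \<not> L \<subseteq> H}"

definition regions :: "'a::euclidean_space set \<Rightarrow> 'a set set \<Rightarrow> 'a set set" where
  "regions V \<A> = {closure C |C. C \<in> components (V - \<Union>\<A>)}"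

text \<open>The empty set satisfies \<open>face_of\<close> and is excluded explicitly here and in the normal fan.\<close>

definition arrangement_fan :: "'a::euclidean_space set \<Rightarrow> 'a set set \<Rightarrow> 'a set set" where
  "arrangement_fan V \<A> = {F. F \<noteq> {} \<and> (\<exists>R\<in>regions V \<A>. F face_of R)}"

section \<open>Polytopes in a subspace\<close>

text \<open>For \<open>F \<subseteq> P\<close> the condition says that \<open>c \<bullet> x\<close> is the maximum of \<open>c \<bullet> y\<close> over \<open>y \<in> P\<close>,
  for every \<open>x \<in> F\<close>.\<close>

definition normal_cone :: "'a::euclidean_space set \<Rightarrow> 'a set \<Rightarrow> 'a set \<Rightarrow> 'a set" where
  "normal_cone V P F = {c \<in> V. \<forall>x\<in>F. \<forall>y\<in>P. c \<bullet> y \<le> c \<bullet> x}"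

definition normal_fan :: "'a::euclidean_space set \<Rightarrow> 'a set \<Rightarrow> 'a set set" where
  "normal_fan V P = {normal_cone V P F |F. F face_of P \<and> F \<noteq> {}}"

text \<open>Sums of sets are Minkowski sums; for \<open>n = 0\<close> the zonotope is a point.\<close>

definition zonotope_in :: "'a::euclidean_space set \<Rightarrow> 'a set \<Rightarrow> bool" where
  "zonotope_in V P \<longleftrightarrow>
     (\<exists>t\<in>V. \<exists>(n::nat) z. (\<forall>i<n. z i \<in> V) \<and>
        P = {t} + (\<Sum>i<n. closed_segment (- z i) (z i)))"

text \<open>The centre is taken in \<open>V\<close>, so that \<open>sphere a r \<inter> V\<close> is a sphere of \<open>V\<close>. Radius \<open>0\<close> is
  allowed, so that a point is inscribed also when \<open>V = {0}\<close>.\<close>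

definition inscribed_in :: "'a::euclidean_space set \<Rightarrow> 'a set \<Rightarrow> bool" where
  "inscribed_in V P \<longleftrightarrow> (\<exists>a\<in>V. \<exists>r. {v. v extreme_point_of P} \<subseteq> sphere a r)"

definition strongly_inscribable :: "'a::euclidean_space set \<Rightarrow> 'a set set \<Rightarrow> bool" where
  "strongly_inscribable V \<A> \<longleftrightarrow>
     linear_arrangement V \<A> \<and>
     (\<exists>P. zonotope_in V P \<and> inscribed_in V P \<and> normal_fan V P = arrangement_fan V \<A>)"

end

theory Submission
  imports Defs
begin

text \<open>
  Let \<open>\<Phi>\<close> be the set of unit roots of \<open>W\<close> and \<open>p\<close> the orthogonal projection onto the flat \<open>L\<close>. The
  projected zonotope, the sum of the segments \<open>[- p \<alpha>, p \<alpha>]\<close> over \<open>\<alpha> \<in> \<Phi>\<close>, has the fan of the restricted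
  arrangement as its normal fan, and its vertices are the vectors \<open>p T\<close> with
  \<open>T = (\<Sum>\<alpha>\<in>\<Phi>. sgn (c \<bullet> \<alpha>) \<alpha>)\<close>, for \<open>c \<in> L\<close> off the restricted hyperplanes. A reflection
  in \<open>W\<close> that fixes \<open>L\<close> pointwise permutes \<open>\<Phi>\<close> and fixes \<open>c\<close>, so it fixes \<open>T\<close>; hence \<open>T \<in> L\<close>
  and \<open>p T = T\<close>. For \<open>L = UNIV\<close> all these vertices are conjugate under \<open>W\<close> and have the same norm. In
  general, moving \<open>c\<close> slightly in a fixed regular direction \<open>g\<close> adds to \<open>T\<close> a fixed vector of the orthogonal
  complement of \<open>L\<close> and gives a vertex for \<open>UNIV\<close>, so by Pythagoras the norm of \<open>T\<close> does not
  depend on \<open>c\<close>.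
\<close>

section \<open>Normal fans of zonotopes\<close>

definition zonotope :: "'i set \<Rightarrow> ('i \<Rightarrow> 'a::euclidean_space) \<Rightarrow> 'a set" where
  "zonotope I z = (\<Sum>i\<in>I. closed_segment (- z i) (z i))"

text \<open>The face on which \<open>c\<close> is maximal, described by coefficients:
  \<open>a i\<close> must be \<open>sgn (c \<bullet> z i)\<close> where this product is nonzero and
  is free in [-1, 1] where it vanishes.\<close>

definition zonotope_face :: "'i set \<Rightarrow> ('i \<Rightarrow> 'a::euclidean_space) \<Rightarrow> 'a \<Rightarrow> 'a set" where
  "zonotope_face I z c =
     {\<Sum>i\<in>I. a i *\<^sub>R z i |a. \<forall>i\<in>I. \<bar>a i\<bar> \<le> 1 \<and> a i * (c \<bullet> z i) = \<bar>c \<bullet> z i\<bar>}"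

text \<open>The vectors of \<open>V\<close> whose sign vector arises from that of \<open>c\<close>
  by turning some nonzero signs into zeros. These cones are the common description of the two fans
  to be compared.\<close>

definition sign_cone :: "'a set \<Rightarrow> 'i set \<Rightarrow> ('i \<Rightarrow> 'a::euclidean_space) \<Rightarrow> 'a \<Rightarrow> 'a set" where
  "sign_cone V I z c =
     {x\<in>V. \<forall>i\<in>I. (c \<bullet> z i = 0 \<longrightarrow> x \<bullet> z i = 0) \<and> 0 \<le> (c \<bullet> z i) * (x \<bullet> z i)}"

text \<open>Indices with \<open>z i = 0\<close> are exempt: a root orthogonal to the flat projects
  to 0 and defines no hyperplane there.\<close>

definition generic :: "'i set \<Rightarrow> ('i \<Rightarrow> 'a::euclidean_space) \<Rightarrow> 'a \<Rightarrow> bool" where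
  "generic I z c \<longleftrightarrow> (\<forall>i\<in>I. z i \<noteq> 0 \<longrightarrow> c \<bullet> z i \<noteq> 0)"

section \<open>Small perturbations and generic vectors\<close>

lemma perturbation_signs:
  fixes z :: "'i \<Rightarrow> 'a::euclidean_space"
  assumes "finite I"
  obtains e where "e > 0" "\<And>i. i \<in> I \<Longrightarrow> c \<bullet> z i \<noteq> 0 \<Longrightarrow> sgn ((c + e *\<^sub>R g) \<bullet> z i) = sgn (c \<bullet> z i)"
proof -
  have "\<forall>\<^sub>F e in at_right 0. c \<bullet> z i \<noteq> 0 \<longrightarrow> sgn ((c + e *\<^sub>R g) \<bullet> z i) = sgn (c \<bullet> z i)" for i
  proof (cases "c \<bullet> z i = 0")
    case False
    have lim: "((\<lambda>e. (c + e *\<^sub>R g) \<bullet> z i) \<longlongrightarrow> (c + 0 *\<^sub>R g) \<bullet> z i) (at_right 0)"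
      by (intro tendsto_intros)
    consider "c \<bullet> z i > 0" | "c \<bullet> z i < 0" using False by linarith
    then show ?thesis
    proof cases
      case 1
      then show ?thesis using order_tendstoD(1)[OF lim, of 0] by (auto elim: eventually_mono)
    next
      case 2
      then show ?thesis using order_tendstoD(2)[OF lim, of 0] by (auto elim: eventually_mono)
    qed
  qed simp
  then have "\<forall>\<^sub>F e in at_right 0. \<forall>i\<in>I. c \<bullet> z i \<noteq> 0 \<longrightarrow> sgn ((c + e *\<^sub>R g) \<bullet> z i) = sgn (c \<bullet> z i)"
    using assms by (simp add: eventually_ball_finite)
  moreover have "\<forall>\<^sub>F e::real in at_right 0. e > 0"
    by (simp add: eventually_at_right_less)
  ultimately have "\<forall>\<^sub>F e::real in at_right 0. e > 0 \<and>
      (\<forall>i\<in>I. c \<bullet> z i \<noteq> 0 \<longrightarrow> sgn ((c + e *\<^sub>R g) \<bullet> z i) = sgn (c \<bullet> z i))"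
    by (rule eventually_conj[rotated])
  then obtain e where "e > 0" "\<forall>i\<in>I. c \<bullet> z i \<noteq> 0 \<longrightarrow> sgn ((c + e *\<^sub>R g) \<bullet> z i) = sgn (c \<bullet> z i)"
    using eventually_happens[of _ "at_right (0::real)"] by (auto simp: trivial_limit_at_right_real)
  with that show thesis by blast
qed

text \<open>Induction on \<open>I\<close>: a small multiple of the new \<open>z j\<close> makes the
  product with \<open>z j\<close> nonzero if it was zero, and is too small to destroy the products
  that are already nonzero.\<close>

lemma generic_exists:
  fixes z :: "'i \<Rightarrow> 'a::euclidean_space"
  assumes "finite I" "subspace V" "\<And>i. i \<in> I \<Longrightarrow> z i \<in> V"
  obtains g where "g \<in> V" "generic I z g"
proof -
  have "\<exists>g\<in>V. generic I z g"
    using assms(1,3)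
  proof (induction I)
    case empty
    then show ?case using assms(2) by (auto simp: generic_def intro: subspace_0)
  next
    case (insert j I)
    then obtain g where g: "g \<in> V" "generic I z g" by auto
    obtain e where e: "e > 0"
      "\<And>i. i \<in> insert j I \<Longrightarrow> g \<bullet> z i \<noteq> 0 \<Longrightarrow> sgn ((g + e *\<^sub>R z j) \<bullet> z i) = sgn (g \<bullet> z i)"
      using perturbation_signs[of "insert j I" g z "z j"] insert.hyps by auto
    have "(g + e *\<^sub>R z j) \<bullet> z i \<noteq> 0" if "i \<in> insert j I" "g \<bullet> z i \<noteq> 0" for i
      using e(2)[OF that] that(2) by (metis sgn_0_0)
    moreover have "(g + e *\<^sub>R z j) \<bullet> z j \<noteq> 0" if "z j \<noteq> 0" "g \<bullet> z j = 0"
      using that e(1) by (simp add: inner_add_left)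
    ultimately have "generic (insert j I) z (g + e *\<^sub>R z j)"
      using g(2) by (auto simp: generic_def)
    moreover have "g + e *\<^sub>R z j \<in> V"
      using assms(2) g insert.prems by (auto intro: subspace_add subspace_scale)
    ultimately show ?case by blast
  qed
  then show thesis using that by blast
qed

section \<open>Zonotopes in coefficients and their faces\<close>

lemma zonotope_eq:
  fixes z :: "'i \<Rightarrow> 'a::euclidean_space"
  assumes "finite I"
  shows "zonotope I z = {\<Sum>i\<in>I. a i *\<^sub>R z i |a. \<forall>i\<in>I. \<bar>a i\<bar> \<le> 1}"
proof -
  \<comment> \<open>The segment parameter \<open>u\<close> in [0, 1] and the coefficient
    \<open>a\<close> in [-1, 1] correspond by \<open>a = 2 * u - 1\<close>.\<close>
  have seg: "x \<in> closed_segment (- y) y \<longleftrightarrow> (\<exists>a. \<bar>a\<bar> \<le> 1 \<and> x = a *\<^sub>R y)" for x y :: 'a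
  proof
    assume "x \<in> closed_segment (- y) y"
    then obtain u where u: "0 \<le> u" "u \<le> 1" "x = (1 - u) *\<^sub>R (- y) + u *\<^sub>R y"
      by (auto simp: in_segment)
    then show "\<exists>a. \<bar>a\<bar> \<le> 1 \<and> x = a *\<^sub>R y"
      by (intro exI[of _ "2 * u - 1"]) (auto simp: algebra_simps scaleR_2 simp flip: scaleR_scaleR)
  next
    assume "\<exists>a. \<bar>a\<bar> \<le> 1 \<and> x = a *\<^sub>R y"
    then obtain a where a: "\<bar>a\<bar> \<le> 1" "x = a *\<^sub>R y" by blast
    have "x = (1 - (a + 1) / 2) *\<^sub>R (- y) + ((a + 1) / 2) *\<^sub>R y"
      unfolding a(2) scaleR_minus_right scaleR_minus_left[symmetric] scaleR_left_distrib[symmetric]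
      by (simp add: field_simps)
    then show "x \<in> closed_segment (- y) y"
      using a(1) unfolding in_segment by (intro exI[of _ "(a + 1) / 2"]) auto
  qed
  show ?thesis
  proof (intro equalityI subsetI)
    fix x assume "x \<in> zonotope I z"
    then obtain s where s: "x = sum s I" "\<forall>i\<in>I. s i \<in> closed_segment (- z i) (z i)"
      unfolding zonotope_def set_sum_alt[OF assms] by blast
    then have "\<forall>i\<in>I. \<exists>a. \<bar>a\<bar> \<le> 1 \<and> s i = a *\<^sub>R z i" by (simp add: seg)
    then obtain a where "\<forall>i\<in>I. \<bar>a i\<bar> \<le> 1 \<and> s i = a i *\<^sub>R z i" by metis
    then show "x \<in> {\<Sum>i\<in>I. a i *\<^sub>R z i |a. \<forall>i\<in>I. \<bar>a i\<bar> \<le> 1}"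
      using s(1) by (auto intro!: exI[of _ a] sum.cong)
  next
    fix x assume "x \<in> {\<Sum>i\<in>I. a i *\<^sub>R z i |a. \<forall>i\<in>I. \<bar>a i\<bar> \<le> 1}"
    then obtain a where a: "x = (\<Sum>i\<in>I. a i *\<^sub>R z i)" "\<forall>i\<in>I. \<bar>a i\<bar> \<le> 1" by blast
    then have "\<forall>i\<in>I. a i *\<^sub>R z i \<in> closed_segment (- z i) (z i)" by (auto simp: seg)
    with a(1) show "x \<in> zonotope I z"
      unfolding zonotope_def set_sum_alt[OF assms] by blast
  qed
qed

text \<open>Convex hulls commute with Minkowski sums, so the zonotope is the hull of the finite sum
  of the pairs of endpoints.\<close>

lemma polytope_zonotope:
  assumes "finite I"
  shows "polytope (zonotope I z)"
proof -
  have "zonotope I z = convex hull (\<Sum>i\<in>I. {- z i, z i})"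
    unfolding zonotope_def convex_hull_set_sum by (simp add: segment_convex_hull)
  moreover have "finite (\<Sum>i\<in>I. {- z i, z i})"
    using assms by (induction I) (auto intro: finite_set_plus)
  ultimately show ?thesis by (auto simp: polytope_def)
qed

lemma inner_sum_le:
  fixes z :: "'i \<Rightarrow> 'a::euclidean_space"
  assumes "\<forall>i\<in>I. \<bar>a i\<bar> \<le> 1"
  shows "c \<bullet> (\<Sum>i\<in>I. a i *\<^sub>R z i) \<le> (\<Sum>i\<in>I. \<bar>c \<bullet> z i\<bar>)"
proof -
  have "a i * (c \<bullet> z i) \<le> \<bar>c \<bullet> z i\<bar>" if "i \<in> I" for i
  proof -
    have "a i * (c \<bullet> z i) \<le> \<bar>a i\<bar> * \<bar>c \<bullet> z i\<bar>" by (metis abs_ge_self abs_mult)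
    also have "\<dots> \<le> 1 * \<bar>c \<bullet> z i\<bar>" using assms that by (intro mult_right_mono) auto
    finally show ?thesis by simp
  qed
  then show ?thesis by (auto simp: inner_sum_right intro: sum_mono)
qed

text \<open>The inequality holds term by term, so equality of the sums forces equality in each
  term.\<close>

lemma inner_sum_eq_iff:
  fixes z :: "'i \<Rightarrow> 'a::euclidean_space"
  assumes "finite I" "\<forall>i\<in>I. \<bar>a i\<bar> \<le> 1"
  shows "c \<bullet> (\<Sum>i\<in>I. a i *\<^sub>R z i) = (\<Sum>i\<in>I. \<bar>c \<bullet> z i\<bar>) \<longleftrightarrow>
         (\<forall>i\<in>I. a i * (c \<bullet> z i) = \<bar>c \<bullet> z i\<bar>)"
proof -
  have le: "a i * (c \<bullet> z i) \<le> \<bar>c \<bullet> z i\<bar>" if "i \<in> I" for i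
    using inner_sum_le[of "{i}" a c z] assms(2) that by simp
  show ?thesis
    unfolding inner_sum_right inner_scaleR_right
  proof
    assume eq: "(\<Sum>i\<in>I. a i * (c \<bullet> z i)) = (\<Sum>i\<in>I. \<bar>c \<bullet> z i\<bar>)"
    show "\<forall>i\<in>I. a i * (c \<bullet> z i) = \<bar>c \<bullet> z i\<bar>"
      using sum_mono_inv[OF eq le _ assms(1)] by blast
  qed simp
qed

lemma zonotope_face_eq:
  fixes z :: "'i \<Rightarrow> 'a::euclidean_space"
  assumes "finite I"
  shows "zonotope_face I z c = zonotope I z \<inter> {x. c \<bullet> x = (\<Sum>i\<in>I. \<bar>c \<bullet> z i\<bar>)}"
proof (intro equalityI subsetI)
  fix x assume "x \<in> zonotope_face I z c"
  then obtain a where a: "x = (\<Sum>i\<in>I. a i *\<^sub>R z i)"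
    "\<forall>i\<in>I. \<bar>a i\<bar> \<le> 1" "\<forall>i\<in>I. a i * (c \<bullet> z i) = \<bar>c \<bullet> z i\<bar>"
    unfolding zonotope_face_def by auto
  then have "x \<in> zonotope I z" unfolding zonotope_eq[OF assms] by auto
  with a show "x \<in> zonotope I z \<inter> {x. c \<bullet> x = (\<Sum>i\<in>I. \<bar>c \<bullet> z i\<bar>)}"
    using inner_sum_eq_iff[OF assms a(2), of c z] by simp
next
  fix x assume x: "x \<in> zonotope I z \<inter> {x. c \<bullet> x = (\<Sum>i\<in>I. \<bar>c \<bullet> z i\<bar>)}"
  then obtain a where a: "x = (\<Sum>i\<in>I. a i *\<^sub>R z i)" "\<forall>i\<in>I. \<bar>a i\<bar> \<le> 1"
    unfolding zonotope_eq[OF assms] by auto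
  then have "\<forall>i\<in>I. a i * (c \<bullet> z i) = \<bar>c \<bullet> z i\<bar>"
    using inner_sum_eq_iff[OF assms a(2), of c z] x by simp
  with a show "x \<in> zonotope_face I z c" unfolding zonotope_face_def by auto
qed

lemma sgn_mult_self_le: "\<bar>sgn t\<bar> \<le> 1" "sgn t * t = \<bar>t\<bar>" for t :: real
  by (cases t "0::real" rule: linorder_cases; simp)+

lemma eq_sgn_if_mult_eq_abs: "a = sgn t" if "a * t = \<bar>t\<bar>" "t \<noteq> 0" for a t :: real
  using mult_right_cancel[OF that(2), of a "sgn t"] that(1) sgn_mult_self_le(2)[of t] by simp

lemma sgn_mult_eq_abs_iff: "sgn t * s = \<bar>s\<bar> \<longleftrightarrow> 0 \<le> t * s" if "t \<noteq> 0" for s t :: real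
  using that by (cases t "0::real" rule: linorder_cases) (auto simp: zero_le_mult_iff)

text \<open>Since \<open>sgn 0 = 0\<close>, the free coefficients are set to 0, so this is the
  centre of the face for every \<open>c\<close>, and a vertex when \<open>c\<close> is generic. It
  also shows that the face is nonempty.\<close>

lemma zonotope_face_vertex: "(\<Sum>i\<in>I. sgn (c \<bullet> z i) *\<^sub>R z i) \<in> zonotope_face I z c"
  unfolding zonotope_face_def
  by (intro CollectI exI[of _ "\<lambda>i. sgn (c \<bullet> z i)"] conjI refl ballI sgn_mult_self_le)

lemma inner_zonotope_le:
  assumes "finite I" "x \<in> zonotope I z"
  shows "c \<bullet> x \<le> (\<Sum>i\<in>I. \<bar>c \<bullet> z i\<bar>)"
  using assms(2) unfolding zonotope_eq[OF assms(1)] by (auto intro: inner_sum_le)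

lemma zonotope_face_face_of:
  assumes "finite I"
  shows "zonotope_face I z c face_of zonotope I z"
  unfolding zonotope_face_eq[OF assms]
  by (intro face_of_Int_supporting_hyperplane_le polytope_imp_convex polytope_zonotope assms
      inner_zonotope_le)

lemma projection_exists:
  fixes V :: "'a::euclidean_space set"
  assumes "subspace V"
  shows "\<exists>y\<in>V. \<forall>w\<in>V. x \<bullet> w = y \<bullet> w"
proof -
  obtain y z where "y \<in> span V" "\<And>w. w \<in> span V \<Longrightarrow> orthogonal z w" "x = y + z"
    using orthogonal_subspace_decomp_exists by blast
  moreover have "span V = V" using assms by (simp add: span_eq_iff)
  ultimately show ?thesis
    by (intro bexI[of _ y]) (auto simp: orthogonal_def inner_add_left)
qed

text \<open>Faces of a polytope are exposed. The exposing vector may be projected onto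
  \<open>V\<close>, because the face depends only on its products with the \<open>z i\<close>, which
  lie in \<open>V\<close>.\<close>

lemma face_of_zonotope:
  fixes z :: "'i \<Rightarrow> 'a::euclidean_space"
  assumes "finite I" "subspace V" "\<And>i. i \<in> I \<Longrightarrow> z i \<in> V"
    and F: "F face_of zonotope I z" "F \<noteq> {}"
  obtains c where "c \<in> V" "F = zonotope_face I z c"
proof -
  have "F exposed_face_of zonotope I z"
    using F(1) exposed_face_of_polyhedron[OF polytope_imp_polyhedron[OF polytope_zonotope[OF assms(1)]],
        of F z] by simp
  then obtain a b where ab: "zonotope I z \<subseteq> {x. a \<bullet> x \<le> b}" "F = zonotope I z \<inter> {x. a \<bullet> x = b}"
    unfolding exposed_face_of_def by blast
  obtain c where c: "c \<in> V" "\<forall>w\<in>V. a \<bullet> w = c \<bullet> w"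
    using projection_exists[OF assms(2)] by blast
  obtain x where x: "x \<in> zonotope I z" "a \<bullet> x = b" using F(2) ab(2) by blast
  \<comment> \<open>The bound \<open>b\<close> is attained on \<open>F\<close>, so it is the maximum
    of \<open>a\<close> over the zonotope, which is the sum of the
    \<open>\<bar>a \<bullet> z i\<bar>\<close>.\<close>
  have "b \<le> (\<Sum>i\<in>I. \<bar>a \<bullet> z i\<bar>)" using inner_zonotope_le[OF assms(1) x(1), of a] x(2) by simp
  moreover have "(\<Sum>i\<in>I. \<bar>a \<bullet> z i\<bar>) \<le> b"
    using zonotope_face_vertex[of a z I] ab(1) unfolding zonotope_face_eq[OF assms(1)] by auto
  ultimately have "F = zonotope_face I z a"
    unfolding zonotope_face_eq[OF assms(1)] ab(2) by simp
  also have "\<dots> = zonotope_face I z c"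
  proof -
    have "a \<bullet> z i = c \<bullet> z i" if "i \<in> I" for i using c(2) assms(3) that by blast
    then have "\<And>w. (\<forall>i\<in>I. \<bar>w i\<bar> \<le> 1 \<and> w i * (a \<bullet> z i) = \<bar>a \<bullet> z i\<bar>) \<longleftrightarrow>
        (\<forall>i\<in>I. \<bar>w i\<bar> \<le> 1 \<and> w i * (c \<bullet> z i) = \<bar>c \<bullet> z i\<bar>)"
      by simp
    then show ?thesis unfolding zonotope_face_def by presburger
  qed
  finally show thesis using that c(1) by blast
qed

section \<open>Normal cones and vertices\<close>

lemma normal_cone_zonotope_face:
  fixes z :: "'i \<Rightarrow> 'a::euclidean_space"
  assumes "finite I"
  shows "normal_cone V (zonotope I z) (zonotope_face I z c) = sign_cone V I z c"
proof (intro equalityI subsetI)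
  fix x assume x: "x \<in> normal_cone V (zonotope I z) (zonotope_face I z c)"
  \<comment> \<open>On the whole face \<open>x\<close> attains its maximum over the zonotope, so
    every admissible choice of coefficients for \<open>c\<close> is optimal for \<open>x\<close>,
    term by term.\<close>
  have max: "a i * (x \<bullet> z i) = \<bar>x \<bullet> z i\<bar>"
    if a: "\<forall>i\<in>I. \<bar>a i\<bar> \<le> 1 \<and> a i * (c \<bullet> z i) = \<bar>c \<bullet> z i\<bar>" and "i \<in> I" for a i
  proof -
    have mem: "(\<Sum>i\<in>I. a i *\<^sub>R z i) \<in> zonotope_face I z c"
      using a unfolding zonotope_face_def by blast
    have "(\<Sum>i\<in>I. sgn (x \<bullet> z i) *\<^sub>R z i) \<in> zonotope I z"
         "x \<bullet> (\<Sum>i\<in>I. sgn (x \<bullet> z i) *\<^sub>R z i) = (\<Sum>i\<in>I. \<bar>x \<bullet> z i\<bar>)"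
      using zonotope_face_vertex[of x z I] unfolding zonotope_face_eq[OF assms] by auto
    then have "(\<Sum>i\<in>I. \<bar>x \<bullet> z i\<bar>) \<le> x \<bullet> (\<Sum>i\<in>I. a i *\<^sub>R z i)"
      using x mem unfolding normal_cone_def by force
    moreover have "x \<bullet> (\<Sum>i\<in>I. a i *\<^sub>R z i) \<le> (\<Sum>i\<in>I. \<bar>x \<bullet> z i\<bar>)"
      using a by (intro inner_sum_le) auto
    ultimately have "x \<bullet> (\<Sum>i\<in>I. a i *\<^sub>R z i) = (\<Sum>i\<in>I. \<bar>x \<bullet> z i\<bar>)" by simp
    then show ?thesis using a inner_sum_eq_iff[OF assms, of a x z] \<open>i \<in> I\<close> by blast
  qed
  have "x \<bullet> z i = 0" if "i \<in> I" "c \<bullet> z i = 0" for i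
  proof -
    \<comment> \<open>Where \<open>c \<bullet> z i\<close> vanishes the coefficient \<open>s\<close>
      may be 1 or -1. Optimality of both choices gives \<open>x \<bullet> z i = \<bar>x \<bullet> z
      i\<bar> = - (x \<bullet> z i)\<close>.\<close>
    define a where "a s j = (if c \<bullet> z j = 0 then s else sgn (c \<bullet> z j))" for s :: real and j
    have "\<forall>j\<in>I. \<bar>a s j\<bar> \<le> 1 \<and> a s j * (c \<bullet> z j) = \<bar>c \<bullet> z j\<bar>" if "\<bar>s\<bar> \<le> 1" for s
      using that by (simp add: a_def sgn_mult_self_le)
    from max[OF this[of 1] that(1)] max[OF this[of "-1"] that(1)] that(2) show ?thesis
      by (simp add: a_def)
  qed
  moreover have "0 \<le> (c \<bullet> z i) * (x \<bullet> z i)" if "i \<in> I" for i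
  proof (cases "c \<bullet> z i = 0")
    case False
    have "sgn (c \<bullet> z i) * (x \<bullet> z i) = \<bar>x \<bullet> z i\<bar>"
      by (rule max[OF _ that]) (simp add: sgn_mult_self_le)
    with False show ?thesis by (simp add: sgn_mult_eq_abs_iff)
  qed simp
  ultimately show "x \<in> sign_cone V I z c"
    using x by (auto simp: sign_cone_def normal_cone_def)
next
  fix x assume x: "x \<in> sign_cone V I z c"
  have "x \<bullet> p = (\<Sum>i\<in>I. \<bar>x \<bullet> z i\<bar>)" if p: "p \<in> zonotope_face I z c" for p
  proof -
    obtain a where a: "p = (\<Sum>i\<in>I. a i *\<^sub>R z i)"
      "\<forall>i\<in>I. \<bar>a i\<bar> \<le> 1 \<and> a i * (c \<bullet> z i) = \<bar>c \<bullet> z i\<bar>"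
      using p unfolding zonotope_face_def by auto
    have "a i * (x \<bullet> z i) = \<bar>x \<bullet> z i\<bar>" if i: "i \<in> I" for i
    proof (cases "c \<bullet> z i = 0")
      case True
      then show ?thesis using x i by (simp add: sign_cone_def)
    next
      case False
      then have "a i = sgn (c \<bullet> z i)" using a(2) i by (blast intro: eq_sgn_if_mult_eq_abs)
      moreover have "0 \<le> (c \<bullet> z i) * (x \<bullet> z i)" using x i by (simp add: sign_cone_def)
      ultimately show ?thesis using False by (simp add: sgn_mult_eq_abs_iff)
    qed
    then show ?thesis unfolding a(1) using a(2) inner_sum_eq_iff[OF assms, of a x z] by blast
  qed
  then show "x \<in> normal_cone V (zonotope I z) (zonotope_face I z c)"
    using x inner_zonotope_le[OF assms] by (auto simp: normal_cone_def sign_cone_def)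
qed

lemma normal_fan_zonotope:
  fixes z :: "'i \<Rightarrow> 'a::euclidean_space"
  assumes "finite I" "subspace V" "\<And>i. i \<in> I \<Longrightarrow> z i \<in> V"
  shows "normal_fan V (zonotope I z) = sign_cone V I z ` V"
proof (intro equalityI subsetI)
  fix N assume "N \<in> normal_fan V (zonotope I z)"
  then obtain F where F: "N = normal_cone V (zonotope I z) F" "F face_of zonotope I z" "F \<noteq> {}"
    unfolding normal_fan_def by blast
  obtain c where "c \<in> V" "F = zonotope_face I z c"
    using face_of_zonotope[where z = z, OF assms F(2,3)] by blast
  then show "N \<in> sign_cone V I z ` V"
    using F(1) normal_cone_zonotope_face[OF assms(1), of V z c] by auto
next
  fix N assume "N \<in> sign_cone V I z ` V"
  then obtain c where N: "N = sign_cone V I z c" by blast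
  have "zonotope_face I z c face_of zonotope I z \<and> zonotope_face I z c \<noteq> {}"
    using zonotope_face_face_of[OF assms(1)] zonotope_face_vertex by blast
  then show "N \<in> normal_fan V (zonotope I z)"
    unfolding normal_fan_def N using normal_cone_zonotope_face[OF assms(1), of V z c] by force
qed

lemma extreme_point_of_zonotope:
  fixes z :: "'i \<Rightarrow> 'a::euclidean_space"
  assumes "finite I" "subspace V" "\<And>i. i \<in> I \<Longrightarrow> z i \<in> V"
    and v: "v extreme_point_of zonotope I z"
  obtains c where "c \<in> V" "generic I z c" "v = (\<Sum>i\<in>I. sgn (c \<bullet> z i) *\<^sub>R z i)"
proof -
  have "{v} face_of zonotope I z" using v by (simp add: face_of_singleton)
  then obtain c where c: "c \<in> V" "{v} = zonotope_face I z c"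
    using face_of_zonotope[where z = z, OF assms(1-3)] by blast
  have v_eq: "v = (\<Sum>i\<in>I. sgn (c \<bullet> z i) *\<^sub>R z i)"
    using zonotope_face_vertex[of c z I] unfolding c(2)[symmetric] by simp
  have "generic I z c"
    unfolding generic_def
  proof (intro ballI impI notI)
    fix i assume i: "i \<in> I" "z i \<noteq> 0" "c \<bullet> z i = 0"
    \<comment> \<open>Raising the free coefficient of \<open>z i\<close> from
      \<open>sgn 0 = 0\<close> to 1 stays in the face but moves the point by \<open>z i\<close>,
      which is impossible in a singleton face.\<close>
    define a where "a j = (if j = i then 1 else sgn (c \<bullet> z j))" for j
    have "(\<Sum>j\<in>I. a j *\<^sub>R z j) \<in> zonotope_face I z c"
      unfolding zonotope_face_def
      by (intro CollectI exI[of _ a]) (use i in \<open>simp add: a_def sgn_mult_self_le\<close>)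
    then have "(\<Sum>j\<in>I. a j *\<^sub>R z j) = (\<Sum>j\<in>I. sgn (c \<bullet> z j) *\<^sub>R z j)"
      using c(2) v_eq by blast
    moreover have "(\<Sum>j\<in>I. a j *\<^sub>R z j) = (\<Sum>j\<in>I. sgn (c \<bullet> z j) *\<^sub>R z j) + z i"
      using i assms(1) by (simp add: a_def sum.remove[of I i])
    ultimately show False using i(2) by simp
  qed
  then show thesis using that c(1) v_eq by blast
qed

section \<open>Sign cones and their faces\<close>

lemma convex_sign_cone:
  assumes "subspace V"
  shows "convex (sign_cone V I z c)"
proof (rule convexI)
  fix x y and u v :: real
  assume xy: "x \<in> sign_cone V I z c" "y \<in> sign_cone V I z c" and uv: "0 \<le> u" "0 \<le> v" "u + v = 1"
  have "(c \<bullet> z i) * ((u *\<^sub>R x + v *\<^sub>R y) \<bullet> z i)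
      = u * ((c \<bullet> z i) * (x \<bullet> z i)) + v * ((c \<bullet> z i) * (y \<bullet> z i))" for i
    by (simp add: inner_add_left algebra_simps)
  then show "u *\<^sub>R x + v *\<^sub>R y \<in> sign_cone V I z c"
    using xy uv assms by (auto simp: sign_cone_def inner_add_left intro: subspace_add subspace_scale)
qed

lemma sign_cone_self: "c \<in> V \<Longrightarrow> c \<in> sign_cone V I z c"
  by (simp add: sign_cone_def)

text \<open>Each segment from a point \<open>x\<close> of the cone to \<open>c\<close> can be
  prolonged a little beyond \<open>c\<close>: nonzero signs of \<open>c\<close> survive a small
  move, and where \<open>c\<close> vanishes so does \<open>x\<close>.\<close>

lemma rel_interior_sign_cone:
  assumes "finite I" "subspace V" "c \<in> V"
  shows "c \<in> rel_interior (sign_cone V I z c)"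
proof -
  have "\<exists>e>1. (1 - e) *\<^sub>R x + e *\<^sub>R c \<in> sign_cone V I z c" if x: "x \<in> sign_cone V I z c" for x
  proof -
    obtain e where e: "e > 0"
      "\<And>i. i \<in> I \<Longrightarrow> c \<bullet> z i \<noteq> 0 \<Longrightarrow> sgn ((c + e *\<^sub>R (c - x)) \<bullet> z i) = sgn (c \<bullet> z i)"
      using perturbation_signs[OF assms(1)] by blast
    have eq: "(1 - (1 + e)) *\<^sub>R x + (1 + e) *\<^sub>R c = c + e *\<^sub>R (c - x)"
      by (simp add: algebra_simps)
    have "0 \<le> (c \<bullet> z i) * ((c + e *\<^sub>R (c - x)) \<bullet> z i)" if "i \<in> I" for i
      using e(2)[OF that] by (cases "c \<bullet> z i = 0") (auto simp: sgn_if zero_le_mult_iff split: if_splits)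
    moreover have "c + e *\<^sub>R (c - x) \<in> V"
      using assms(2,3) x by (auto simp: sign_cone_def intro!: subspace_add subspace_scale subspace_diff)
    ultimately have "c + e *\<^sub>R (c - x) \<in> sign_cone V I z c"
      using x by (auto simp: sign_cone_def inner_add_left inner_diff_left)
    then show ?thesis using e(1) eq by (intro exI[of _ "1 + e"]) auto
  qed
  then show ?thesis
    using convex_rel_interior_iff[OF convex_sign_cone[OF assms(2)]] sign_cone_self[OF assms(3)]
    by blast
qed

text \<open>The signs of \<open>c'\<close> are those of \<open>c\<close> with some replaced by zero,
  so its cone is cut out of the larger one by turning weak inequalities into equations.\<close>

lemma sign_cone_face_of:
  assumes "subspace V" "c' \<in> sign_cone V I z c"
  shows "sign_cone V I z c' face_of sign_cone V I z c"
proof -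
  have sub: "sign_cone V I z c' \<subseteq> sign_cone V I z c"
  proof
    fix x assume x: "x \<in> sign_cone V I z c'"
    have "(c \<bullet> z i = 0 \<longrightarrow> x \<bullet> z i = 0) \<and> 0 \<le> (c \<bullet> z i) * (x \<bullet> z i)" if "i \<in> I" for i
    proof -
      have "(c' \<bullet> z i = 0 \<longrightarrow> x \<bullet> z i = 0) \<and> 0 \<le> (c' \<bullet> z i) * (x \<bullet> z i)"
        "(c \<bullet> z i = 0 \<longrightarrow> c' \<bullet> z i = 0) \<and> 0 \<le> (c \<bullet> z i) * (c' \<bullet> z i)"
        using x assms(2) that by (auto simp: sign_cone_def)
      then show ?thesis by (cases "c' \<bullet> z i = 0") (auto simp: zero_le_mult_iff)
    qed
    then show "x \<in> sign_cone V I z c" using x by (auto simp: sign_cone_def)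
  qed
  moreover have "a \<in> sign_cone V I z c' \<and> b \<in> sign_cone V I z c'"
    if ab: "a \<in> sign_cone V I z c" "b \<in> sign_cone V I z c" and x: "x \<in> sign_cone V I z c'"
      "x \<in> open_segment a b" for a b x
  proof -
    obtain u where u: "0 < u" "u < 1" "x = (1 - u) *\<^sub>R a + u *\<^sub>R b"
      using x(2) by (auto simp: in_segment)
    have "(c' \<bullet> z i = 0 \<longrightarrow> a \<bullet> z i = 0 \<and> b \<bullet> z i = 0) \<and> 0 \<le> (c' \<bullet> z i) * (a \<bullet> z i)
        \<and> 0 \<le> (c' \<bullet> z i) * (b \<bullet> z i)" if i: "i \<in> I" for i
    proof -
      have cc: "c \<bullet> z i = 0 \<longrightarrow> c' \<bullet> z i = 0" "0 \<le> (c \<bullet> z i) * (c' \<bullet> z i)"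
        and xc: "c' \<bullet> z i = 0 \<longrightarrow> x \<bullet> z i = 0"
        and a: "c \<bullet> z i = 0 \<longrightarrow> a \<bullet> z i = 0" "0 \<le> (c \<bullet> z i) * (a \<bullet> z i)"
        and b: "c \<bullet> z i = 0 \<longrightarrow> b \<bullet> z i = 0" "0 \<le> (c \<bullet> z i) * (b \<bullet> z i)"
        using assms(2) x(1) ab i by (auto simp: sign_cone_def)
      show ?thesis
      proof (cases "c' \<bullet> z i = 0")
        case True
        \<comment> \<open>Two nonnegative numbers with a vanishing combination of positive weights
          are both zero, so \<open>a\<close> and \<open>b\<close> lie on the hyperplane together
          with \<open>x\<close>.\<close>
        have "(1 - u) * ((c \<bullet> z i) * (a \<bullet> z i)) + u * ((c \<bullet> z i) * (b \<bullet> z i)) = (c \<bullet> z i) * (x \<bullet> z i)"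
          unfolding u(3) by (simp add: inner_add_left algebra_simps)
        also have "\<dots> = 0" using xc True by simp
        finally have "(1 - u) * ((c \<bullet> z i) * (a \<bullet> z i)) = 0 \<and> u * ((c \<bullet> z i) * (b \<bullet> z i)) = 0"
          using a(2) b(2) u(1,2) by (subst (asm) add_nonneg_eq_0_iff) auto
        then show ?thesis using u(1,2) a(1) b(1) True by auto
      next
        case False
        then show ?thesis using cc a b by (auto simp: zero_le_mult_iff)
      qed
    qed
    then show ?thesis using ab by (auto simp: sign_cone_def)
  qed
  ultimately show ?thesis
    unfolding face_of_def using convex_sign_cone[OF assms(1)] by blast
qed

text \<open>Take \<open>c'\<close> in the relative interior of \<open>F\<close>. The sign cone of
  \<open>c'\<close> is also a face with \<open>c'\<close> in its relative interior, and two faces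
  whose relative interiors meet are equal.\<close>

lemma face_of_sign_cone:
  assumes "finite I" "subspace V" "F face_of sign_cone V I z c" "F \<noteq> {}"
  obtains c' where "c' \<in> sign_cone V I z c" "F = sign_cone V I z c'"
proof -
  obtain c' where c': "c' \<in> rel_interior F"
    using assms(3,4) face_of_imp_convex rel_interior_eq_empty by blast
  then have mem: "c' \<in> sign_cone V I z c"
    using assms(3) face_of_imp_subset rel_interior_subset by blast
  then have "c' \<in> V" by (simp add: sign_cone_def)
  then have "c' \<in> rel_interior (sign_cone V I z c')"
    using rel_interior_sign_cone assms(1,2) by blast
  then have "F = sign_cone V I z c'"
    using face_of_eq[OF assms(3) sign_cone_face_of[OF assms(2) mem]] c' by blast
  then show thesis using that mem by blast
qed

section \<open>Fans of arrangements\<close>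

text \<open>The last condition makes each piece a maximal connected subset, hence a component. As
  the pieces cover \<open>S\<close> and distinct components are disjoint, there are no
  others.\<close>

lemma components_eqI:
  assumes "pairwise disjnt \<C>" "\<And>C. C \<in> \<C> \<Longrightarrow> connected C \<and> C \<noteq> {}" "\<Union>\<C> = S"
    "\<And>C T. C \<in> \<C> \<Longrightarrow> connected T \<Longrightarrow> T \<subseteq> S \<Longrightarrow> T \<inter> C \<noteq> {} \<Longrightarrow> T \<subseteq> C"
  shows "components S = \<C>"
proof -
  have sub: "C \<in> components S" if "C \<in> \<C>" for C
    unfolding in_components_maximal using assms(2,3,4) that
    by (metis Sup_upper inf.orderE inf_commute subset_antisym)
  moreover have "C \<in> \<C>" if C: "C \<in> components S" for C
  proof -
    obtain x where "x \<in> C" "x \<in> S" using C in_components_nonempty in_components_subset by blast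
    then obtain D where D: "D \<in> \<C>" "x \<in> D" using assms(3) by blast
    then show ?thesis using sub C \<open>x \<in> C\<close> by (metis components_nonoverlap disjoint_iff)
  qed
  ultimately show ?thesis by blast
qed

text \<open>Where \<open>c \<bullet> z i\<close> vanishes, the new product is \<open>e\<close> times
  that of \<open>g\<close>; elsewhere a small \<open>e\<close> keeps the sign.\<close>

lemma generic_perturbation:
  fixes z :: "'i \<Rightarrow> 'a::euclidean_space"
  assumes "finite I" "generic I z g"
  obtains e where "e > 0" "generic I z (c + e *\<^sub>R g)"
    "\<And>i. i \<in> I \<Longrightarrow> c \<bullet> z i \<noteq> 0 \<Longrightarrow> sgn ((c + e *\<^sub>R g) \<bullet> z i) = sgn (c \<bullet> z i)"
proof -
  obtain e where e: "e > 0"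
    "\<And>i. i \<in> I \<Longrightarrow> c \<bullet> z i \<noteq> 0 \<Longrightarrow> sgn ((c + e *\<^sub>R g) \<bullet> z i) = sgn (c \<bullet> z i)"
    using perturbation_signs[OF assms(1)] by blast
  have "(c + e *\<^sub>R g) \<bullet> z i \<noteq> 0" if "i \<in> I" "z i \<noteq> 0" for i
  proof (cases "c \<bullet> z i = 0")
    case True
    then show ?thesis using that assms(2) e(1) by (simp add: generic_def inner_add_left)
  next
    case False
    then show ?thesis using e(2)[OF that(1) False] by (metis sgn_0_0)
  qed
  then show thesis using that e by (simp add: generic_def)
qed

text \<open>The strict counterpart of \<open>sign_cone\<close>: for generic \<open>c\<close> in
  \<open>V\<close>, the component of the complement of the hyperplanes that contains
  \<open>c\<close>.\<close>

definition open_chamber :: "'a set \<Rightarrow> 'i set \<Rightarrow> ('i \<Rightarrow> 'a::euclidean_space) \<Rightarrow> 'a \<Rightarrow> 'a set" where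
  "open_chamber V I z c = {x\<in>V. \<forall>i\<in>I. z i \<noteq> 0 \<longrightarrow> 0 < (c \<bullet> z i) * (x \<bullet> z i)}"

lemma convex_open_chamber:
  assumes "subspace V"
  shows "convex (open_chamber V I z c)"
proof (rule convexI)
  fix x y and u v :: real
  assume xy: "x \<in> open_chamber V I z c" "y \<in> open_chamber V I z c"
    and uv: "0 \<le> u" "0 \<le> v" "u + v = 1"
  have "0 < (c \<bullet> z i) * ((u *\<^sub>R x + v *\<^sub>R y) \<bullet> z i)" if "i \<in> I" "z i \<noteq> 0" for i
  proof -
    have pos: "0 < (c \<bullet> z i) * (x \<bullet> z i)" "0 < (c \<bullet> z i) * (y \<bullet> z i)"
      using xy that by (simp_all add: open_chamber_def)
    have "(c \<bullet> z i) * ((u *\<^sub>R x + v *\<^sub>R y) \<bullet> z i)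
      = u * ((c \<bullet> z i) * (x \<bullet> z i)) + v * ((c \<bullet> z i) * (y \<bullet> z i))"
      by (simp add: inner_add_left algebra_simps)
    moreover have "0 < u * ((c \<bullet> z i) * (x \<bullet> z i)) + v * ((c \<bullet> z i) * (y \<bullet> z i))"
    proof (cases "u = 0")
      case True
      then show ?thesis using uv pos by simp
    next
      case False
      then show ?thesis using uv pos
        by (intro add_pos_nonneg mult_pos_pos[of u] mult_nonneg_nonneg[of v] less_imp_le[OF pos(2)]) auto
    qed
    ultimately show ?thesis by simp
  qed
  moreover have "u *\<^sub>R x + v *\<^sub>R y \<in> V"
    using xy assms by (simp add: open_chamber_def subspace_add subspace_scale)
  ultimately show "u *\<^sub>R x + v *\<^sub>R y \<in> open_chamber V I z c"
    by (simp add: open_chamber_def)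
qed

lemma components_generic:
  fixes z :: "'i \<Rightarrow> 'a::euclidean_space"
  assumes "subspace V"
  shows "components {x\<in>V. generic I z x} = open_chamber V I z ` {c\<in>V. generic I z c}"
proof (rule components_eqI)
  \<comment> \<open>A chamber is determined by any of its points, so chambers that meet
    coincide.\<close>
  have eq: "open_chamber V I z c = open_chamber V I z x" if "x \<in> open_chamber V I z c" for c x
  proof -
    have "0 < (c \<bullet> z i) * (y \<bullet> z i) \<longleftrightarrow> 0 < (x \<bullet> z i) * (y \<bullet> z i)" if "i \<in> I" "z i \<noteq> 0" for i y
      using \<open>x \<in> open_chamber V I z c\<close> that by (auto simp: open_chamber_def zero_less_mult_iff)
    then show ?thesis by (auto simp: open_chamber_def)
  qed
  show "pairwise disjnt (open_chamber V I z ` {c\<in>V. generic I z c})"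
  proof (rule pairwiseI)
    fix C D assume CD: "C \<in> open_chamber V I z ` {c\<in>V. generic I z c}"
      "D \<in> open_chamber V I z ` {c\<in>V. generic I z c}" "C \<noteq> D"
    have "C = D" if "x \<in> C" "x \<in> D" for x
      using CD(1,2) that eq[of x] by auto
    with CD(3) show "disjnt C D" by (auto simp: disjnt_def)
  qed
  have self: "c \<in> open_chamber V I z c" if "c \<in> V" "generic I z c" for c
    using that by (auto simp: open_chamber_def generic_def zero_less_mult_iff linorder_neq_iff)
  show "connected C \<and> C \<noteq> {}" if C: "C \<in> open_chamber V I z ` {c\<in>V. generic I z c}" for C
  proof -
    obtain c where "c \<in> V" "generic I z c" "C = open_chamber V I z c" using C by blast
    then show ?thesis using self convex_connected[OF convex_open_chamber[OF assms]] by blast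
  qed
  have gen: "generic I z x" if "x \<in> open_chamber V I z c" for c x
    using that by (auto simp: open_chamber_def generic_def)
  show "\<Union> (open_chamber V I z ` {c\<in>V. generic I z c}) = {x\<in>V. generic I z x}"
  proof (intro equalityI subsetI)
    fix x assume "x \<in> \<Union> (open_chamber V I z ` {c\<in>V. generic I z c})"
    then obtain c where c: "x \<in> open_chamber V I z c" by blast
    moreover have "x \<in> V" using c by (simp add: open_chamber_def)
    ultimately show "x \<in> {x\<in>V. generic I z x}" using gen by simp
  qed (use self in auto)
  show "T \<subseteq> C" if C: "C \<in> open_chamber V I z ` {c\<in>V. generic I z c}"
    and T: "connected T" "T \<subseteq> {x\<in>V. generic I z x}" "T \<inter> C \<noteq> {}" for C T
  proof
    fix y assume y: "y \<in> T"
    obtain c x where c: "c \<in> V" "generic I z c" "C = open_chamber V I z c" "x \<in> T" "x \<in> C"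
      using C T(3) by auto
    have "0 < (c \<bullet> z i) * (y \<bullet> z i)" if i: "i \<in> I" "z i \<noteq> 0" for i
    proof (rule ccontr)
      assume "\<not> 0 < (c \<bullet> z i) * (y \<bullet> z i)"
      \<comment> \<open>The normal is oriented so that the chamber lies on its positive side. A
        connected set that leaves the chamber has to meet the hyperplane, where no vector is
        generic.\<close>
      then have "((c \<bullet> z i) *\<^sub>R z i) \<bullet> y \<le> 0" by (simp add: inner_commute)
      moreover have "0 \<le> ((c \<bullet> z i) *\<^sub>R z i) \<bullet> x"
        using c(3,5) i by (auto simp: open_chamber_def inner_commute)
      ultimately obtain w where w: "w \<in> T" "((c \<bullet> z i) *\<^sub>R z i) \<bullet> w = 0"
        using connected_ivt_hyperplane[OF T(1) y c(4)] by blast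
      then have "generic I z w" using T(2) by blast
      then show False using w(2) c(2) i by (auto simp: generic_def inner_commute)
    qed
    moreover have "y \<in> V" using y T(2) by blast
    ultimately show "y \<in> C" by (simp add: c(3) open_chamber_def)
  qed
qed

lemma closed_sign_cone:
  fixes z :: "'i \<Rightarrow> 'a::euclidean_space"
  assumes "subspace V"
  shows "closed (sign_cone V I z c)"
proof -
  have "closed {x. c \<bullet> z i = 0 \<longrightarrow> x \<bullet> z i = 0}" for i
    by (cases "c \<bullet> z i = 0") (auto intro!: closed_Collect_eq continuous_intros)
  moreover have "closed {x. 0 \<le> (c \<bullet> z i) * (x \<bullet> z i)}" for i
    by (intro closed_Collect_le continuous_intros)
  moreover have "sign_cone V I z c =
      V \<inter> (\<Inter>i\<in>I. {x. c \<bullet> z i = 0 \<longrightarrow> x \<bullet> z i = 0} \<inter> {x. 0 \<le> (c \<bullet> z i) * (x \<bullet> z i)})"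
    by (auto simp: sign_cone_def)
  ultimately show ?thesis
    using closed_subspace[OF assms] by (auto intro!: closed_Int closed_INT)
qed

lemma closure_open_chamber:
  fixes z :: "'i \<Rightarrow> 'a::euclidean_space"
  assumes "subspace V" "c \<in> V" "generic I z c"
  shows "closure (open_chamber V I z c) = sign_cone V I z c"
proof
  have "open_chamber V I z c \<subseteq> sign_cone V I z c"
  proof
    fix x assume x: "x \<in> open_chamber V I z c"
    have "(c \<bullet> z i = 0 \<longrightarrow> x \<bullet> z i = 0) \<and> 0 \<le> (c \<bullet> z i) * (x \<bullet> z i)" if "i \<in> I" for i
      using x that by (cases "z i = 0") (auto simp: open_chamber_def less_imp_le)
    then show "x \<in> sign_cone V I z c" using x by (simp add: sign_cone_def open_chamber_def)
  qed
  then show "closure (open_chamber V I z c) \<subseteq> sign_cone V I z c"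
    by (intro closure_minimal closed_sign_cone assms(1))
  show "sign_cone V I z c \<subseteq> closure (open_chamber V I z c)"
  proof
    fix x assume x: "x \<in> sign_cone V I z c"
    \<comment> \<open>A small push towards \<open>c\<close> adds a strictly positive amount to each
      weakly positive product, so \<open>x\<close> is a limit of points of the chamber.\<close>
    have "x + (1 / real (Suc n)) *\<^sub>R c \<in> open_chamber V I z c" for n
    proof -
      have "0 < (c \<bullet> z i) * ((x + (1 / real (Suc n)) *\<^sub>R c) \<bullet> z i)" if "i \<in> I" "z i \<noteq> 0" for i
      proof -
        have "0 \<le> (c \<bullet> z i) * (x \<bullet> z i)" using x that by (simp add: sign_cone_def)
        moreover have "0 < (1 / real (Suc n)) * ((c \<bullet> z i) * (c \<bullet> z i))"
          using assms(3) that by (auto simp: generic_def zero_less_mult_iff linorder_neq_iff)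
        ultimately show ?thesis by (simp add: inner_add_left algebra_simps)
      qed
      moreover have "x + (1 / real (Suc n)) *\<^sub>R c \<in> V"
        using x assms(1,2) by (auto simp: sign_cone_def intro: subspace_add subspace_scale)
      ultimately show ?thesis by (simp add: open_chamber_def)
    qed
    moreover have "(\<lambda>n. x + (1 / real (Suc n)) *\<^sub>R c) \<longlonglongrightarrow> x + 0 *\<^sub>R c"
      by (intro tendsto_intros LIMSEQ_Suc lim_1_over_n)
    ultimately show "x \<in> closure (open_chamber V I z c)"
      unfolding closure_sequential by (intro exI[of _ "\<lambda>n. x + (1 / real (Suc n)) *\<^sub>R c"]) simp
  qed
qed

text \<open>The regions are the sign cones of generic vectors, and faces of sign cones are sign
  cones. Conversely, the sign cone of any \<open>c\<close> is a face of the region of a generic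
  vector close to \<open>c\<close>. The right-hand side is also the normal fan of the
  zonotope.\<close>

lemma arrangement_fan_eq_sign_cones:
  fixes z :: "'i \<Rightarrow> 'a::euclidean_space"
  assumes "finite I" "subspace V" "\<And>i. i \<in> I \<Longrightarrow> z i \<in> V"
  shows "arrangement_fan V {{x\<in>V. x \<bullet> z i = 0} |i. i \<in> I \<and> z i \<noteq> 0} = sign_cone V I z ` V"
    (is "arrangement_fan V ?A = _")
proof -
  have "V - \<Union>?A = {x\<in>V. generic I z x}" by (auto simp: generic_def)
  then have "regions V ?A = (\<lambda>c. closure (open_chamber V I z c)) ` {c\<in>V. generic I z c}"
    unfolding regions_def by (auto simp: components_generic[OF assms(2)])
  also have "\<dots> = sign_cone V I z ` {c\<in>V. generic I z c}"
    by (rule image_cong) (simp_all add: closure_open_chamber[OF assms(2)])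
  finally have regions: "regions V ?A = sign_cone V I z ` {c\<in>V. generic I z c}" .
  show ?thesis
  proof (intro equalityI subsetI)
    fix F assume "F \<in> arrangement_fan V ?A"
    then obtain c where c: "F \<noteq> {}" "F face_of sign_cone V I z c"
      unfolding arrangement_fan_def regions by blast
    obtain c' where "c' \<in> sign_cone V I z c" "F = sign_cone V I z c'"
      by (rule face_of_sign_cone[OF assms(1,2) c(2,1)])
    then show "F \<in> sign_cone V I z ` V" by (simp add: sign_cone_def)
  next
    fix F assume "F \<in> sign_cone V I z ` V"
    then obtain c where c: "c \<in> V" "F = sign_cone V I z c" by blast
    obtain g where g: "g \<in> V" "generic I z g"
      by (rule generic_exists[where z = z, OF assms])
    obtain e where e: "generic I z (c + e *\<^sub>R g)"
      "\<And>i. i \<in> I \<Longrightarrow> c \<bullet> z i \<noteq> 0 \<Longrightarrow> sgn ((c + e *\<^sub>R g) \<bullet> z i) = sgn (c \<bullet> z i)"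
      by (rule generic_perturbation[OF assms(1) g(2), of c]) blast
    have V: "c + e *\<^sub>R g \<in> V" using assms(2) c(1) g(1) by (simp add: subspace_add subspace_scale)
    have "((c + e *\<^sub>R g) \<bullet> z i = 0 \<longrightarrow> c \<bullet> z i = 0) \<and> 0 \<le> ((c + e *\<^sub>R g) \<bullet> z i) * (c \<bullet> z i)"
      if "i \<in> I" for i
    proof (cases "c \<bullet> z i = 0")
      case False
      then have "(c + e *\<^sub>R g) \<bullet> z i \<noteq> 0" using e(1) that by (auto simp: generic_def)
      moreover have "sgn ((c + e *\<^sub>R g) \<bullet> z i) * (c \<bullet> z i) = \<bar>c \<bullet> z i\<bar>"
        using e(2)[OF that False] sgn_mult_self_le(2)[of "c \<bullet> z i"] by simp
      ultimately show ?thesis by (simp add: sgn_mult_eq_abs_iff)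
    qed simp
    then have "c \<in> sign_cone V I z (c + e *\<^sub>R g)" using c(1) by (simp add: sign_cone_def)
    then have "F face_of sign_cone V I z (c + e *\<^sub>R g)"
      unfolding c(2) by (rule sign_cone_face_of[OF assms(2)])
    moreover have "F \<noteq> {}" using sign_cone_self c by blast
    ultimately show "F \<in> arrangement_fan V ?A"
      unfolding arrangement_fan_def regions using e(1) V by blast
  qed
qed

section \<open>Roots of finite reflection groups\<close>

text \<open>Each reflecting hyperplane contributes its two opposite unit normals.\<close>

definition unit_roots :: "('a::euclidean_space \<Rightarrow> 'a) set \<Rightarrow> 'a set" where
  "unit_roots W = {\<alpha>. norm \<alpha> = 1 \<and> reflection \<alpha> \<in> W}"

text \<open>For the unit roots and \<open>c\<close> off all hyperplanes this is twice the sum of the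
  positive roots with respect to \<open>c\<close>, as \<open>\<beta>\<close> and
  \<open>- \<beta>\<close> contribute equally.\<close>

definition sign_sum :: "'a::euclidean_space set \<Rightarrow> 'a \<Rightarrow> 'a" where
  "sign_sum \<Phi> c = (\<Sum>\<beta>\<in>\<Phi>. sgn (c \<bullet> \<beta>) *\<^sub>R \<beta>)"

lemma finite_unit_roots:
  assumes "finite W"
  shows "finite (unit_roots W)"
proof -
  have two: "\<beta> = \<alpha> \<or> \<beta> = - \<alpha>"
    if n: "norm \<alpha> = 1" "norm \<beta> = 1" and eq: "reflection \<alpha> = reflection \<beta>" for \<alpha> \<beta> :: 'a
  proof -
    have one: "\<alpha> \<bullet> \<alpha> = 1" "\<beta> \<bullet> \<beta> = 1" using n by (simp_all add: dot_square_norm)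
    \<comment> \<open>The reflection sends \<open>\<beta>\<close> to its negative, which forces
      \<open>\<beta>\<close> to be a multiple of \<open>\<alpha>\<close>; so a reflection determines
      its unit root up to sign.\<close>
    have "reflection \<alpha> \<beta> = - \<beta>" unfolding eq using one by (simp add: reflection_def scaleR_2)
    then have "2 *\<^sub>R \<beta> = 2 *\<^sub>R ((\<alpha> \<bullet> \<beta>) *\<^sub>R \<alpha>)"
      using one by (simp add: reflection_def algebra_simps scaleR_2)
    then have \<beta>: "\<beta> = (\<alpha> \<bullet> \<beta>) *\<^sub>R \<alpha>" by (subst (asm) scaleR_cancel_left) simp
    then have "\<bar>\<alpha> \<bullet> \<beta>\<bar> = 1" using n by (metis norm_scaleR mult.right_neutral)
    then have "\<alpha> \<bullet> \<beta> = 1 \<or> \<alpha> \<bullet> \<beta> = - 1" by linarith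
    then show ?thesis using \<beta> by auto
  qed
  have "finite {\<alpha>. norm \<alpha> = 1 \<and> reflection \<alpha> = f}" (is "finite ?S") for f :: "'a \<Rightarrow> 'a"
  proof (cases "?S = {}")
    case False
    then obtain \<gamma> where \<gamma>: "norm \<gamma> = 1" "reflection \<gamma> = f" by auto
    have "?S \<subseteq> {\<gamma>, - \<gamma>}"
    proof
      fix \<alpha> assume "\<alpha> \<in> ?S"
      then show "\<alpha> \<in> {\<gamma>, - \<gamma>}" using two[of \<gamma> \<alpha>] \<gamma> by simp
    qed
    then show ?thesis by (rule finite_subset) simp
  qed (simp only: finite.emptyI)
  then have "finite (\<Union>f\<in>W. {\<alpha>. norm \<alpha> = 1 \<and> reflection \<alpha> = f})" using assms by simp
  moreover have "unit_roots W = (\<Union>f\<in>W. {\<alpha>. norm \<alpha> = 1 \<and> reflection \<alpha> = f})"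
    by (auto simp: unit_roots_def)
  ultimately show ?thesis by simp
qed

lemma reflection_arrangement_eq: "reflection_arrangement W = hyperplane_perp ` unit_roots W"
proof (intro equalityI subsetI)
  fix H assume "H \<in> reflection_arrangement W"
  then obtain \<alpha> where \<alpha>: "H = hyperplane_perp \<alpha>" "\<alpha> \<noteq> 0" "reflection \<alpha> \<in> W"
    unfolding reflection_arrangement_def by blast
  let ?\<beta> = "(1 / norm \<alpha>) *\<^sub>R \<alpha>"
  have "reflection ?\<beta> = reflection \<alpha>"
    using \<alpha>(2) by (auto simp: reflection_def fun_eq_iff dot_square_norm power2_eq_square)
  moreover have "hyperplane_perp ?\<beta> = H" using \<alpha> by (auto simp: hyperplane_perp_def)
  ultimately show "H \<in> hyperplane_perp ` unit_roots W"
    using \<alpha> by (intro image_eqI[of _ _ ?\<beta>]) (auto simp: unit_roots_def)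
next
  fix H assume "H \<in> hyperplane_perp ` unit_roots W"
  then show "H \<in> reflection_arrangement W"
    by (force simp: reflection_arrangement_def unit_roots_def)
qed

lemma reflection_orthogonal_image:
  assumes "orthogonal_transformation w" "w \<circ> w' = id"
  shows "reflection (w \<alpha>) = w \<circ> reflection \<alpha> \<circ> w'"
proof
  fix x
  have x: "w (w' x) = x" using assms(2) by (simp add: fun_eq_iff)
  have in1: "w \<alpha> \<bullet> x = \<alpha> \<bullet> w' x" "w \<alpha> \<bullet> w \<alpha> = \<alpha> \<bullet> \<alpha>"
    using assms(1) x unfolding orthogonal_transformation_def by metis+
  have lin: "linear w" using assms(1) by (simp add: orthogonal_transformation_def)
  show "reflection (w \<alpha>) x = (w \<circ> reflection \<alpha> \<circ> w') x"
    by (simp add: reflection_def in1 x linear_diff[OF lin] linear_scale[OF lin])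
qed

section \<open>The group action on roots and sign sums\<close>

context
  fixes W :: "('a::euclidean_space \<Rightarrow> 'a) set"
  assumes finite_W: "finite W" and subgroup_W: "subgroup W orthogonal_group"
begin

lemma orthogonal_W: "w \<in> W \<Longrightarrow> orthogonal_transformation w"
  using subgroup.subset[OF subgroup_W] by (auto simp: orthogonal_group_def)

lemma comp_W: "v \<in> W \<Longrightarrow> w \<in> W \<Longrightarrow> v \<circ> w \<in> W"
  using subgroup.m_closed[OF subgroup_W] by (simp add: orthogonal_group_def)

lemma inverse_W:
  assumes "w \<in> W"
  obtains w' where "w' \<in> W" "w \<circ> w' = id"
proof
  show "inv\<^bsub>orthogonal_group\<^esub> w \<in> W"
    using subgroup.m_inv_closed[OF subgroup_W assms] .
  have "w \<in> carrier orthogonal_group" using subgroup.subset[OF subgroup_W] assms by blast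
  from group.r_inv[OF group_orthogonal_group this]
  show "w \<circ> inv\<^bsub>orthogonal_group\<^esub> w = id" by (simp add: orthogonal_group_def)
qed

text \<open>Conjugating the reflection in \<open>\<alpha>\<close> by \<open>w\<close> gives the
  reflection in \<open>w \<alpha>\<close>, so \<open>w\<close> maps roots to roots; an injective
  self-map of a finite set is onto.\<close>

lemma image_unit_roots:
  assumes "w \<in> W"
  shows "w ` unit_roots W = unit_roots W"
proof (rule endo_inj_surj)
  obtain w' where w': "w' \<in> W" "w \<circ> w' = id" by (rule inverse_W[OF assms])
  have "reflection (w \<alpha>) \<in> W" if "reflection \<alpha> \<in> W" for \<alpha>
    unfolding reflection_orthogonal_image[OF orthogonal_W[OF assms] w'(2)]
    by (intro comp_W assms that w'(1))
  then show "w ` unit_roots W \<subseteq> unit_roots W"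
    using orthogonal_transformation_norm[OF orthogonal_W[OF assms]] by (auto simp: unit_roots_def)
  show "inj_on w (unit_roots W)"
    using orthogonal_transformation_inj[OF orthogonal_W[OF assms]] by (rule inj_on_subset) simp
qed (rule finite_unit_roots[OF finite_W])

lemma sign_sum_image:
  assumes "w \<in> W"
  shows "sign_sum (unit_roots W) (w c) = w (sign_sum (unit_roots W) c)"
proof -
  note orth = orthogonal_W[OF assms]
  have lin: "linear w" and inner: "w x \<bullet> w y = x \<bullet> y" for x y
    using orth by (simp_all add: orthogonal_transformation_def)
  have "inj_on w (unit_roots W)"
    using orthogonal_transformation_inj[OF orth] by (rule inj_on_subset) simp
  then have "sign_sum (w ` unit_roots W) (w c) = w (sign_sum (unit_roots W) c)"
    by (simp add: sign_sum_def sum.reindex linear_sum[OF lin] linear_scale[OF lin] inner)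
  then show ?thesis by (simp add: image_unit_roots[OF assms])
qed

text \<open>Choosing \<open>w\<close> to maximise \<open>w c \<bullet> c'\<close> over \<open>W\<close> moves \<open>c\<close> into the chamber of \<open>c'\<close>:
  otherwise reflecting \<open>w c\<close> in a separating hyperplane would increase the inner product.\<close>

lemma norm_sign_sum_eq:
  assumes c: "\<And>\<alpha>. \<alpha> \<in> unit_roots W \<Longrightarrow> c \<bullet> \<alpha> \<noteq> 0"
    and c': "\<And>\<alpha>. \<alpha> \<in> unit_roots W \<Longrightarrow> c' \<bullet> \<alpha> \<noteq> 0"
  shows "norm (sign_sum (unit_roots W) c) = norm (sign_sum (unit_roots W) c')"
proof -
  have "W \<noteq> {}" using subgroup.one_closed[OF subgroup_W] by blast
  then have "Max ((\<lambda>w. w c \<bullet> c') ` W) \<in> (\<lambda>w. w c \<bullet> c') ` W" using finite_W by simp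
  then obtain w where w: "w \<in> W" "Max ((\<lambda>w. w c \<bullet> c') ` W) = w c \<bullet> c'" by auto
  have max: "v c \<bullet> c' \<le> w c \<bullet> c'" if "v \<in> W" for v
    unfolding w(2)[symmetric] using that finite_W by simp
  have "sgn (w c \<bullet> \<alpha>) = sgn (c' \<bullet> \<alpha>)" if \<alpha>: "\<alpha> \<in> unit_roots W" for \<alpha>
  proof -
    have "\<alpha> \<bullet> \<alpha> = 1" "reflection \<alpha> \<in> W" using \<alpha> by (simp_all add: unit_roots_def dot_square_norm)
    then have "(reflection \<alpha> \<circ> w) c \<bullet> c' \<le> w c \<bullet> c'"
      and "(reflection \<alpha> \<circ> w) c \<bullet> c' = w c \<bullet> c' - 2 * (w c \<bullet> \<alpha>) * (c' \<bullet> \<alpha>)"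
      using max[OF comp_W[OF _ w(1), of "reflection \<alpha>"]]
      by (simp_all add: reflection_def inner_diff_left inner_commute[of \<alpha> "w c"] inner_commute[of \<alpha> c'])
    then have ge: "0 \<le> (w c \<bullet> \<alpha>) * (c' \<bullet> \<alpha>)" by linarith
    \<comment> \<open>As \<open>w\<close> permutes the roots, \<open>w c\<close> is off all
      hyperplanes because \<open>c\<close> is, so the nonnegative product is positive and the signs
      agree.\<close>
    obtain \<beta> where \<beta>: "\<beta> \<in> unit_roots W" "\<alpha> = w \<beta>" using image_unit_roots[OF w(1)] \<alpha> by blast
    have "w c \<bullet> \<alpha> = c \<bullet> \<beta>"
      using orthogonal_W[OF w(1)] \<beta>(2) by (simp add: orthogonal_transformation_def)
    then have "w c \<bullet> \<alpha> \<noteq> 0" using c[OF \<beta>(1)] by simp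
    with ge c'[OF \<alpha>] show ?thesis by (auto simp: zero_le_mult_iff)
  qed
  then have "sign_sum (unit_roots W) c' = sign_sum (unit_roots W) (w c)"
    by (simp add: sign_sum_def)
  also have "norm \<dots> = norm (sign_sum (unit_roots W) c)"
    unfolding sign_sum_image[OF w(1)]
    by (rule orthogonal_transformation_norm[OF orthogonal_W[OF w(1)]])
  finally show ?thesis by simp
qed

lemma sign_sum_mem_perp:
  assumes \<alpha>: "\<alpha> \<in> unit_roots W" and "\<alpha> \<bullet> c = 0"
  shows "\<alpha> \<bullet> sign_sum (unit_roots W) c = 0"
proof -
  let ?T = "sign_sum (unit_roots W) c"
  have one: "\<alpha> \<bullet> \<alpha> = 1" "reflection \<alpha> \<in> W" using \<alpha> by (simp_all add: unit_roots_def dot_square_norm)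
  have "reflection \<alpha> c = c" using assms(2) by (simp add: reflection_def)
  then have "reflection \<alpha> ?T = ?T" using sign_sum_image[OF one(2), of c] by simp
  then have "\<alpha> \<bullet> reflection \<alpha> ?T = \<alpha> \<bullet> ?T" by simp
  then show ?thesis using one(1) by (simp add: reflection_def inner_diff_right)
qed

text \<open>Adding to \<open>c\<close> a small multiple of a regular vector \<open>g\<close> turns the sign sum of \<open>c\<close> into that of a
  regular vector, by adding the part of the sign sum of \<open>g\<close> that is orthogonal to \<open>L\<close>.\<close>

lemma norm_sign_sum_eq_on_flat:
  fixes L :: "'a set"
  defines "\<Phi>0 \<equiv> {\<alpha>\<in>unit_roots W. \<forall>x\<in>L. \<alpha> \<bullet> x = 0}"
  assumes L: "L = {x. \<forall>\<alpha>\<in>\<Phi>0. \<alpha> \<bullet> x = 0}"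
    and c: "c \<in> L" "\<And>\<alpha>. \<alpha> \<in> unit_roots W - \<Phi>0 \<Longrightarrow> c \<bullet> \<alpha> \<noteq> 0"
    and c': "c' \<in> L" "\<And>\<alpha>. \<alpha> \<in> unit_roots W - \<Phi>0 \<Longrightarrow> c' \<bullet> \<alpha> \<noteq> 0"
  shows "norm (sign_sum (unit_roots W) c) = norm (sign_sum (unit_roots W) c')"
proof -
  let ?\<Phi> = "unit_roots W"
  note fin = finite_unit_roots[OF finite_W]
  obtain g where g: "generic ?\<Phi> (\<lambda>\<alpha>. \<alpha>) g"
    using generic_exists[OF fin subspace_UNIV, of "\<lambda>\<alpha>. \<alpha>"] by auto
  define U where "U = sign_sum \<Phi>0 g"
  have "\<exists>h. (\<forall>\<alpha>\<in>?\<Phi>. h \<bullet> \<alpha> \<noteq> 0) \<and> (norm (sign_sum ?\<Phi> h))\<^sup>2 = (norm (sign_sum ?\<Phi> b))\<^sup>2 + (norm U)\<^sup>2"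
    if b: "b \<in> L" "\<And>\<alpha>. \<alpha> \<in> ?\<Phi> - \<Phi>0 \<Longrightarrow> b \<bullet> \<alpha> \<noteq> 0" for b
  proof -
    obtain e where e: "e > 0" "generic ?\<Phi> (\<lambda>\<alpha>. \<alpha>) (b + e *\<^sub>R g)"
      "\<And>\<alpha>. \<alpha> \<in> ?\<Phi> \<Longrightarrow> b \<bullet> \<alpha> \<noteq> 0 \<Longrightarrow> sgn ((b + e *\<^sub>R g) \<bullet> \<alpha>) = sgn (b \<bullet> \<alpha>)"
      by (rule generic_perturbation[OF fin g, of b]) blast
    have b0: "b \<bullet> \<alpha> = 0" if "\<alpha> \<in> \<Phi>0" for \<alpha>
      using that b(1) inner_commute[of b \<alpha>] by (simp add: \<Phi>0_def)
    \<comment> \<open>On \<open>\<Phi>0\<close> the sign for \<open>b\<close> is 0 and the sign for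
      \<open>g\<close> takes its place; off \<open>\<Phi>0\<close> the sign for \<open>b\<close>
      survives the small perturbation.\<close>
    have "sign_sum ?\<Phi> (b + e *\<^sub>R g) = (\<Sum>\<alpha>\<in>?\<Phi>. sgn (b \<bullet> \<alpha>) *\<^sub>R \<alpha> + (if \<alpha> \<in> \<Phi>0 then sgn (g \<bullet> \<alpha>) *\<^sub>R \<alpha> else 0))"
      unfolding sign_sum_def
    proof (rule sum.cong[OF refl])
      fix \<alpha> assume \<alpha>: "\<alpha> \<in> ?\<Phi>"
      show "sgn ((b + e *\<^sub>R g) \<bullet> \<alpha>) *\<^sub>R \<alpha>
          = sgn (b \<bullet> \<alpha>) *\<^sub>R \<alpha> + (if \<alpha> \<in> \<Phi>0 then sgn (g \<bullet> \<alpha>) *\<^sub>R \<alpha> else 0)"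
        using e(1) e(3)[OF \<alpha>] b(2)[of \<alpha>] b0[of \<alpha>] \<alpha>
        by (cases "\<alpha> \<in> \<Phi>0") (simp_all add: inner_add_left sgn_mult)
    qed
    also have "\<dots> = sign_sum ?\<Phi> b + U"
      using fin by (simp add: sum.distrib sign_sum_def U_def \<Phi>0_def sum.inter_filter)
    finally have eq: "sign_sum ?\<Phi> (b + e *\<^sub>R g) = sign_sum ?\<Phi> b + U" .
    have "sign_sum ?\<Phi> b \<bullet> \<alpha> = 0" if "\<alpha> \<in> \<Phi>0" for \<alpha>
      using sign_sum_mem_perp[of \<alpha> b] b0[OF that] that by (simp add: \<Phi>0_def inner_commute)
    then have "orthogonal (sign_sum ?\<Phi> b) U"
      by (simp add: orthogonal_def U_def sign_sum_def[of \<Phi>0] inner_sum_right)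
    then have "(norm (sign_sum ?\<Phi> (b + e *\<^sub>R g)))\<^sup>2 = (norm (sign_sum ?\<Phi> b))\<^sup>2 + (norm U)\<^sup>2"
      unfolding eq by (rule norm_add_Pythagorean)
    moreover have "\<forall>\<alpha>\<in>?\<Phi>. (b + e *\<^sub>R g) \<bullet> \<alpha> \<noteq> 0"
    proof
      fix \<alpha> assume \<alpha>: "\<alpha> \<in> ?\<Phi>"
      then have "\<alpha> \<noteq> 0" by (auto simp: unit_roots_def)
      then show "(b + e *\<^sub>R g) \<bullet> \<alpha> \<noteq> 0" using e(2) \<alpha> unfolding generic_def by blast
    qed
    ultimately show ?thesis by blast
  qed
  \<comment> \<open>The vectors \<open>h\<close> and \<open>h'\<close> are off all hyperplanes, so
    their sign sums have equal norms. The term from \<open>U\<close> is the same for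
    \<open>c\<close> and \<open>c'\<close> and cancels.\<close>
  from this[OF c] this[OF c'] obtain h h' where
    "\<forall>\<alpha>\<in>?\<Phi>. h \<bullet> \<alpha> \<noteq> 0" "(norm (sign_sum ?\<Phi> h))\<^sup>2 = (norm (sign_sum ?\<Phi> c))\<^sup>2 + (norm U)\<^sup>2"
    "\<forall>\<alpha>\<in>?\<Phi>. h' \<bullet> \<alpha> \<noteq> 0" "(norm (sign_sum ?\<Phi> h'))\<^sup>2 = (norm (sign_sum ?\<Phi> c'))\<^sup>2 + (norm U)\<^sup>2"
    by blast
  moreover from this have "norm (sign_sum ?\<Phi> h) = norm (sign_sum ?\<Phi> h')"
    by (intro norm_sign_sum_eq) auto
  ultimately have "(norm (sign_sum ?\<Phi> c))\<^sup>2 = (norm (sign_sum ?\<Phi> c'))\<^sup>2" by simp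
  then show ?thesis by (simp add: power2_eq_iff_nonneg)
qed

end

section \<open>Restriction to a flat\<close>

lemma zonotope_in_zonotope:
  assumes "finite I" "subspace V" "\<And>i. i \<in> I \<Longrightarrow> z i \<in> V"
  shows "zonotope_in V (zonotope I z)"
proof -
  obtain h where h: "bij_betw h {..<card I} I"
    using ex_bij_betw_nat_finite[OF assms(1)] by (auto simp: atLeast0LessThan)
  have "zonotope I z = (\<Sum>i<card I. closed_segment (- z (h i)) (z (h i)))"
    unfolding zonotope_def by (rule sum.reindex_bij_betw[OF h, symmetric])
  then have "zonotope I z = {0} + (\<Sum>i<card I. closed_segment (- z (h i)) (z (h i)))"
    by (simp flip: set_zero)
  moreover have "\<forall>i<card I. z (h i) \<in> V"
    using h assms(3) by (auto simp: bij_betw_def)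
  ultimately show ?thesis
    unfolding zonotope_in_def using subspace_0[OF assms(2)]
    by (intro bexI[of _ 0] exI[of _ "card I"] exI[of _ "\<lambda>i. z (h i)"]) simp_all
qed

lemma dim_hyperplane_in_subspace:
  fixes a :: "'a::euclidean_space"
  assumes "subspace V" "a \<in> V" "a \<noteq> 0"
  shows "dim {x\<in>V. x \<bullet> a = 0} + 1 = dim V"
proof -
  have "dim {x\<in>V. \<forall>y\<in>span {a}. orthogonal y x} + dim (span {a}) = dim V"
    using assms by (intro dim_subspace_orthogonal_to_vectors) (auto simp: span_minimal)
  moreover have "{x\<in>V. \<forall>y\<in>span {a}. orthogonal y x} = {x\<in>V. x \<bullet> a = 0}"
    by (auto simp: span_singleton orthogonal_def inner_commute)
  ultimately show ?thesis using assms(3) by (simp add: dim_singleton)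
qed

lemma strongly_inscribable_restriction:
  fixes W :: "('a::euclidean_space \<Rightarrow> 'a) set"
  assumes W: "finite W" "subgroup W orthogonal_group" and "L \<in> flats (reflection_arrangement W)"
  shows "strongly_inscribable L (restriction (reflection_arrangement W) L)"
proof -
  define \<Phi> where "\<Phi> = unit_roots W"
  define \<Phi>0 where "\<Phi>0 = {\<alpha>\<in>\<Phi>. \<forall>x\<in>L. \<alpha> \<bullet> x = 0}"
  have fin: "finite \<Phi>" unfolding \<Phi>_def by (rule finite_unit_roots[OF W(1)])
  obtain B where B: "B \<subseteq> hyperplane_perp ` \<Phi>" "L = \<Inter>B"
    using assms(3) unfolding flats_def reflection_arrangement_eq \<Phi>_def by blast
  \<comment> \<open>A hyperplane used to cut out \<open>L\<close> contains \<open>L\<close>, so its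
    unit normals lie in \<open>\<Phi>0\<close>; hence all of \<open>\<Phi>0\<close> together cuts
    out \<open>L\<close>.\<close>
  have L: "L = {x. \<forall>\<alpha>\<in>\<Phi>0. \<alpha> \<bullet> x = 0}"
  proof (intro equalityI subsetI)
    fix x assume x: "x \<in> {x. \<forall>\<alpha>\<in>\<Phi>0. \<alpha> \<bullet> x = 0}"
    have "x \<in> H" if "H \<in> B" for H
    proof -
      have "H \<in> hyperplane_perp ` \<Phi>" using B(1) that by (rule subsetD)
      then obtain \<alpha> where \<alpha>: "\<alpha> \<in> \<Phi>" "H = hyperplane_perp \<alpha>" by auto
      then have "\<alpha> \<in> \<Phi>0" using B(2) that by (auto simp: \<Phi>0_def hyperplane_perp_def)
      with x \<alpha>(2) show ?thesis by (simp add: hyperplane_perp_def)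
    qed
    then show "x \<in> L" using B(2) by blast
  qed (simp add: \<Phi>0_def)
  have sub: "subspace L"
    unfolding L by (auto simp: subspace_def inner_add_right)
  obtain p where p: "\<And>\<alpha>. p \<alpha> \<in> L" "\<And>\<alpha> x. x \<in> L \<Longrightarrow> \<alpha> \<bullet> x = p \<alpha> \<bullet> x"
    using projection_exists[OF sub] by metis
  \<comment> \<open>The roots with zero projection are those whose hyperplanes contain
    \<open>L\<close>, which are exactly the hyperplanes that the restriction omits.\<close>
  have p0: "p \<alpha> \<noteq> 0 \<longleftrightarrow> \<alpha> \<notin> \<Phi>0" if "\<alpha> \<in> \<Phi>" for \<alpha>
  proof
    show "\<alpha> \<notin> \<Phi>0 \<Longrightarrow> p \<alpha> \<noteq> 0" using that p(2)[of _ \<alpha>] by (auto simp: \<Phi>0_def)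
    assume "p \<alpha> \<noteq> 0"
    moreover have "\<alpha> \<bullet> p \<alpha> = p \<alpha> \<bullet> p \<alpha>" using p by blast
    ultimately have "\<alpha> \<bullet> p \<alpha> \<noteq> 0" by simp
    then show "\<alpha> \<notin> \<Phi>0" using p(1)[of \<alpha>] unfolding \<Phi>0_def by blast
  qed
  have A: "restriction (reflection_arrangement W) L = {{x\<in>L. x \<bullet> p \<alpha> = 0} |\<alpha>. \<alpha> \<in> \<Phi> \<and> p \<alpha> \<noteq> 0}"
    (is "_ = ?A")
  proof -
    have int: "hyperplane_perp \<alpha> \<inter> L = {x\<in>L. x \<bullet> p \<alpha> = 0}" for \<alpha>
      using p(2)[of _ \<alpha>] by (auto simp: hyperplane_perp_def inner_commute)
    have "\<not> L \<subseteq> hyperplane_perp \<alpha> \<longleftrightarrow> p \<alpha> \<noteq> 0" if "\<alpha> \<in> \<Phi>" for \<alpha>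
      using p0[OF that] that by (auto simp: hyperplane_perp_def \<Phi>0_def)
    then have "{\<alpha>\<in>\<Phi>. \<not> L \<subseteq> hyperplane_perp \<alpha>} = {\<alpha>\<in>\<Phi>. p \<alpha> \<noteq> 0}" by auto
    moreover have "restriction (reflection_arrangement W) L
        = (\<lambda>\<alpha>. hyperplane_perp \<alpha> \<inter> L) ` {\<alpha>\<in>\<Phi>. \<not> L \<subseteq> hyperplane_perp \<alpha>}"
      unfolding restriction_def reflection_arrangement_eq \<Phi>_def[symmetric] by auto
    moreover have "?A = (\<lambda>\<alpha>. {x\<in>L. x \<bullet> p \<alpha> = 0}) ` {\<alpha>\<in>\<Phi>. p \<alpha> \<noteq> 0}" by auto
    ultimately show ?thesis by (simp add: int)
  qed
  have "linear_arrangement L ?A"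
    unfolding linear_arrangement_def
  proof (intro conjI ballI)
    have "finite ((\<lambda>\<alpha>. {x\<in>L. x \<bullet> p \<alpha> = 0}) ` \<Phi>)" using fin by simp
    then show "finite ?A" by (rule rev_finite_subset) auto
  next
    fix H assume "H \<in> ?A"
    then obtain \<alpha> where \<alpha>: "H = {x\<in>L. x \<bullet> p \<alpha> = 0}" "p \<alpha> \<noteq> 0" by blast
    then show "dim H + 1 = dim L" using dim_hyperplane_in_subspace[OF sub p(1)] by simp
    show "subspace H" using sub unfolding \<alpha>(1) by (auto simp: subspace_def inner_add_left)
    show "H \<subseteq> L" using \<alpha>(1) by blast
  qed (rule sub)
  moreover have "normal_fan L (zonotope \<Phi> p) = arrangement_fan L ?A"
    using normal_fan_zonotope[where z = p, OF fin sub p(1)]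
      arrangement_fan_eq_sign_cones[where z = p, OF fin sub p(1)] by simp
  moreover have "zonotope_in L (zonotope \<Phi> p)"
    by (rule zonotope_in_zonotope[OF fin sub p(1)])
  moreover have "inscribed_in L (zonotope \<Phi> p)"
  proof -
    have vertex: "\<exists>c\<in>L. (\<forall>\<alpha>\<in>\<Phi> - \<Phi>0. c \<bullet> \<alpha> \<noteq> 0) \<and> v = sign_sum \<Phi> c"
      if v: "v extreme_point_of zonotope \<Phi> p" for v
    proof -
      obtain c where c: "c \<in> L" "generic \<Phi> p c" "v = (\<Sum>\<alpha>\<in>\<Phi>. sgn (c \<bullet> p \<alpha>) *\<^sub>R p \<alpha>)"
        by (rule extreme_point_of_zonotope[where z = p, OF fin sub p(1) v])
      have cp: "c \<bullet> p \<alpha> = c \<bullet> \<alpha>" for \<alpha> using p(2)[OF c(1), of \<alpha>] by (simp add: inner_commute)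
      let ?T = "sign_sum \<Phi> c"
      have "\<alpha> \<bullet> ?T = 0" if "\<alpha> \<in> \<Phi>0" for \<alpha>
        using sign_sum_mem_perp[OF W, of \<alpha> c] that c(1) by (simp add: \<Phi>_def \<Phi>0_def)
      then have "?T \<in> L" unfolding L by simp
      moreover have "v \<in> L" unfolding c(3) by (intro subspace_sum sub subspace_scale p(1))
      ultimately have d: "?T - v \<in> L" by (intro subspace_diff sub)
      \<comment> \<open>The difference lies in \<open>L\<close> but is a combination of the vectors
        \<open>\<alpha> - p \<alpha>\<close>, all orthogonal to \<open>L\<close>. It is orthogonal
        to itself and vanishes.\<close>
      have "?T - v = (\<Sum>\<alpha>\<in>\<Phi>. sgn (c \<bullet> \<alpha>) *\<^sub>R (\<alpha> - p \<alpha>))"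
        by (simp add: c(3) cp sign_sum_def sum_subtractf scaleR_diff_right)
      then have "(?T - v) \<bullet> (?T - v) = (\<Sum>\<alpha>\<in>\<Phi>. sgn (c \<bullet> \<alpha>) *\<^sub>R (\<alpha> - p \<alpha>)) \<bullet> (?T - v)"
        by simp
      also have "\<dots> = 0"
        using p(2)[OF d] by (simp add: inner_sum_left inner_diff_left)
      finally have "v = ?T" by simp
      moreover have "\<forall>\<alpha>\<in>\<Phi> - \<Phi>0. c \<bullet> \<alpha> \<noteq> 0" using c(2) p0 cp by (auto simp: generic_def)
      ultimately show ?thesis using c(1) by blast
    qed
    \<comment> \<open>A reference vector that supplies the radius: every vertex is the sign sum of
      some \<open>c\<close> in \<open>L\<close> off the restricted hyperplanes, and so has the norm
      of the sign sum of \<open>g\<close>. The centre is 0.\<close>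
    obtain g where g: "g \<in> L" "generic \<Phi> p g"
      by (rule generic_exists[where z = p, OF fin sub p(1)])
    have gp: "g \<bullet> p \<alpha> = g \<bullet> \<alpha>" for \<alpha> using p(2)[OF g(1), of \<alpha>] by (simp add: inner_commute)
    have g0: "g \<bullet> \<alpha> \<noteq> 0" if "\<alpha> \<in> \<Phi> - \<Phi>0" for \<alpha>
      using that g(2) p0[of \<alpha>] gp[of \<alpha>] by (auto simp: generic_def)
    have "norm v = norm (sign_sum \<Phi> g)" if v: "v extreme_point_of zonotope \<Phi> p" for v
    proof -
      obtain c where c: "c \<in> L" "\<And>\<alpha>. \<alpha> \<in> \<Phi> - \<Phi>0 \<Longrightarrow> c \<bullet> \<alpha> \<noteq> 0" "v = sign_sum \<Phi> c"
        using vertex[OF v] by blast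
      show ?thesis
        unfolding c(3) \<Phi>_def
        by (rule norm_sign_sum_eq_on_flat[OF W L[unfolded \<Phi>0_def \<Phi>_def] c(1) _ g(1)];
            fold \<Phi>_def; fold \<Phi>0_def; fact c(2) g0)
    qed
    then have "{v. v extreme_point_of zonotope \<Phi> p} \<subseteq> sphere 0 (norm (sign_sum \<Phi> g))" by auto
    then show ?thesis unfolding inscribed_in_def using subspace_0[OF sub] by blast
  qed
  ultimately show ?thesis unfolding strongly_inscribable_def A by blast
qed

theorem proposition1p3:
  fixes W :: "(real^'d \<Rightarrow> real^'d) set"
  assumes "finite_reflection_group W"
  shows "strongly_inscribable UNIV (reflection_arrangement W) \<and>
         (\<forall>L \<in> flats (reflection_arrangement W).
            strongly_inscribable L (restriction (reflection_arrangement W) L))"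
proof -
  have W: "finite W" "subgroup W orthogonal_group"
    using assms by (simp_all add: finite_reflection_group_def)
  \<comment> \<open>The first claim is the case \<open>L = UNIV\<close>, the flat given by the empty
    intersection. Since no hyperplane is the whole space, restricting to it discards
    nothing.\<close>
  have "UNIV \<notin> reflection_arrangement W"
    unfolding reflection_arrangement_eq
  proof
    assume "UNIV \<in> hyperplane_perp ` unit_roots W"
    then obtain \<alpha> :: "real^'d" where \<alpha>: "UNIV = hyperplane_perp \<alpha>" "norm \<alpha> = 1"
      by (auto simp: unit_roots_def)
    have "\<alpha> \<in> hyperplane_perp \<alpha>" unfolding \<alpha>(1)[symmetric] by simp
    with \<alpha>(2) show False by (auto simp: hyperplane_perp_def)
  qed
  then have "restriction (reflection_arrangement W) UNIV = reflection_arrangement W"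
    by (auto simp: restriction_def top.extremum_unique)
  moreover have "UNIV \<in> flats (reflection_arrangement W)"
    unfolding flats_def by (intro CollectI exI[of _ "{}"]) simp
  ultimately show ?thesis
    using strongly_inscribable_restriction[OF W] by metis
qed

end
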